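(* Let $X$ be a Banach space, let $\mu\in\mathcal{A}_\infty$, and let $\mathcal{U}=\{U(t,s)\}_{t\ge s}$ be an evolution family on $X$ for which there are constants $\alpha>0$, $K\ge 1$ with $\|U(s,\tau)\|\le Ke^{\alpha(\mu(s)-\mu(\tau))}$ for all $s\ge\tau$. Let $\{T_t\}_{t\ge 0}$ be the generalized evolution semigroup on $C_0(\mathbb{R},X)$, $$T_tu(s)=U(s,\mu^{-1}(\mu(s)-t))\,u(\mu^{-1}(\mu(s)-t)),\quad t\ge 0,\ s\in\mathbb{R},$$ with generator $(G,D(G))$. Set $V(t,s)=U(\mu^{-1}(t),\mu^{-1}(s))$ for $t\ge s$; this is an evolution family on $X$ with $\|V(t,s)\|\le Ke^{\alpha(t-s)}$ for $t\ge s$. Let $\{S_t\}_{t\ge 0}$ be the classical evolution semigroup on $C_0(\mathbb{R},X)$, $$S_tv(s)=V(s,s-t)v(s-t),\quad t\ge 0,\ s\in\mathbb{R},$$ with generator $(A,D(A))$. Let $\mathcal{F}:C_0(\mathbb{R},X)\to C_0(\mathbb{R},X)$, $\mathcal{F}u=u\circ\mu^{-1}$, which is an invertible bounded linear operator with inverse $\mathcal{F}^{-1}v=v\circ\mu$. Then $\{T_t\}_{t\ge0}$ and $\{S_t\}_{t\ge0}$ are similar: $$T_t=\mathcal{F}^{-1}S_t\,\mathcal{F}\quad\text{for all } t\ge 0.$$ Consequently $D(G)=\{u\in C_0(\mathbb{R},X): u\circ\mu^{-1}\in D(A)\}$, $Gu=\mathcal{F}^{-1}A\mathcal{F}u=\big(A(u\circ\mu^{-1})\big)\circ\mu$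 for $u\in D(G)$, and $\sigma(G)=\sigma(A)$.
   Context: $\mathcal{A}_\infty$ is the set of continuous, strictly increasing functions $\mu:\mathbb{R}\to\mathbb{R}$ with $\lim_{s\to-\infty}\mu(s)=-\infty$ and $\lim_{s\to+\infty}\mu(s)=+\infty$. A (strongly continuous) evolution family on $X$ is a collection of bounded linear operators $U(t,s)$, $t\ge s$ in $\mathbb{R}$, on $X$ such that $U(t,t)=\mathrm{Id}$ for all $t$; $U(t,\tau)U(\tau,t_0)=U(t,t_0)$ for $t\ge\tau\ge t_0$; and for each $x\in X$ the map $(t,s)\mapsto U(t,s)x$ is continuous on $\{(t,s)\in\mathbb{R}^2: t\ge s\}$. $C_0(\mathbb{R},X)$ is the Banach space of continuous functions $u:\mathbb{R}\to X$ with $\lim_{|s|\to\infty}u(s)=0$, with the sup-norm. Under the stated hypotheses both $\{T_t\}_{t\ge 0}$ and $\{S_t\}_{t\ge 0}$ are $C_0$-semigroups on $C_0(\mathbb{R},X)$. $\sigma(\cdot)$ denotes the spectrum. *)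

theory Defs
  imports "HOL-Analysis.Analysis"
begin

text \<open>
  Banach spaces over a scalar field \<open>'k\<close>. The library class \<^class>\<open>banach\<close> only provides real
  scalars, whereas spectra are usually taken over the complex numbers. A scalar multiplication
  satisfying the following axioms turns a space of that class into a normed space over \<open>'k\<close> with
  the same norm and underlying real structure. By the Gelfand-Mazur theorem, \<open>'k\<close> can only be
  (a copy of) the field of real or of complex numbers.
\<close>

locale normed_scaling = vector_space smul
  for smul :: "'k::real_normed_field \<Rightarrow> 'a::real_normed_vector \<Rightarrow> 'a" +
  assumes scale_of_real: "smul (of_real r) x = r *\<^sub>R x"
    and norm_scale: "norm (smul c x) = norm c * norm x"

lemma normed_scaling_scaleR: "normed_scaling (scaleR :: real \<Rightarrow> 'a::real_normed_vector \<Rightarrow> 'a)"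
  by unfold_locales (simp_all add: algebra_simps)

lemma normed_scaling_mult: "normed_scaling ((*) :: complex \<Rightarrow> complex \<Rightarrow> complex)"
  by unfold_locales (simp_all add: algebra_simps norm_mult scaleR_conv_of_real)

definition bounded_operator ::
    "('k::real_normed_field \<Rightarrow> 'a::real_normed_vector \<Rightarrow> 'a) \<Rightarrow> ('a \<Rightarrow> 'a) \<Rightarrow> bool" where
  "bounded_operator smul f \<longleftrightarrow> bounded_linear f \<and> Vector_Spaces.linear smul smul f"


subsection \<open>The space of continuous functions vanishing at infinity\<close>

typedef (overloaded) 'a c0 =
  "{u :: real \<Rightarrow>\<^sub>C 'a::real_normed_vector. (apply_bcontfun u \<longlongrightarrow> 0) at_infinity}"
  by (rule exI[of _ 0]) simp

setup_lifting type_definition_c0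

definition apply_c0 :: "'a::real_normed_vector c0 \<Rightarrow> real \<Rightarrow> 'a" where
  "apply_c0 u = apply_bcontfun (Rep_c0 u)"

text \<open>Only meaningful for continuous functions vanishing at infinity, see \<open>apply_c0_of\<close> below.\<close>

definition c0_of :: "(real \<Rightarrow> 'a::real_normed_vector) \<Rightarrow> 'a c0" where
  "c0_of f = Abs_c0 (Bcontfun f)"

instantiation c0 :: (real_normed_vector) real_vector
begin

lift_definition zero_c0 :: "'a c0" is 0
  by simp

lift_definition plus_c0 :: "'a c0 \<Rightarrow> 'a c0 \<Rightarrow> 'a c0" is "(+)"
  by (auto intro: tendsto_add_zero)

lift_definition minus_c0 :: "'a c0 \<Rightarrow> 'a c0 \<Rightarrow> 'a c0" is "(-)"
  using tendsto_diff by fastforce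

lift_definition uminus_c0 :: "'a c0 \<Rightarrow> 'a c0" is uminus
  using tendsto_minus by fastforce

lift_definition scaleR_c0 :: "real \<Rightarrow> 'a c0 \<Rightarrow> 'a c0" is "(*\<^sub>R)"
  using tendsto_scaleR[OF tendsto_const] by fastforce

instance
proof
  fix u v w :: "'a c0" and a b :: real
  show "u + v + w = u + (v + w)" by transfer (simp add: add.assoc)
  show "u + v = v + u" by transfer (simp add: add.commute)
  show "0 + u = u" by transfer simp
  show "- u + u = 0" by transfer simp
  show "u - v = u + - v" by transfer simp
  show "a *\<^sub>R (u + v) = a *\<^sub>R u + a *\<^sub>R v" by transfer (simp add: scaleR_add_right)
  show "(a + b) *\<^sub>R u = a *\<^sub>R u + b *\<^sub>R u" by transfer (simp add: scaleR_add_left)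
  show "a *\<^sub>R b *\<^sub>R u = (a * b) *\<^sub>R u" by transfer simp
  show "1 *\<^sub>R u = u" by transfer simp
qed

end

instantiation c0 :: (real_normed_vector) real_normed_vector
begin

lift_definition norm_c0 :: "'a c0 \<Rightarrow> real" is norm .

lift_definition dist_c0 :: "'a c0 \<Rightarrow> 'a c0 \<Rightarrow> real" is dist .

definition sgn_c0 :: "'a c0 \<Rightarrow> 'a c0"
  where "sgn_c0 u = u /\<^sub>R norm u"

definition uniformity_c0 :: "('a c0 \<times> 'a c0) filter"
  where "uniformity_c0 = (INF e\<in>{0 <..}. principal {(x, y). dist x y < e})"

definition open_c0 :: "'a c0 set \<Rightarrow> bool"
  where "open_c0 S = (\<forall>x\<in>S. \<forall>\<^sub>F (x', y) in uniformity. x' = x \<longrightarrow> y \<in> S)"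

instance
proof
  fix u v :: "'a c0" and a :: real
  show "dist u v = norm (u - v)" by transfer (simp add: dist_norm)
  show "(norm u = 0) = (u = 0)" by transfer simp
  show "norm (u + v) \<le> norm u + norm v" by transfer (rule norm_triangle_ineq)
  show "norm (a *\<^sub>R u) = \<bar>a\<bar> * norm u" by transfer simp
qed (rule sgn_c0_def uniformity_c0_def open_c0_def)+

end

lemma c0_eqI: "(\<And>s. apply_c0 u s = apply_c0 v s) \<Longrightarrow> u = v"
  unfolding apply_c0_def by (metis Rep_c0_inject bcontfun_eqI)

lemma continuous_apply_c0: "continuous_on A (apply_c0 u)"
  by (simp add: apply_c0_def)

lemma tendsto_apply_c0: "(apply_c0 u \<longlongrightarrow> 0) at_infinity"
  using Rep_c0[of u] by (simp add: apply_c0_def)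

lemma apply_c0_of:
  fixes f :: "real \<Rightarrow> 'a::real_normed_vector"
  assumes cont: "continuous_on UNIV f" and lim: "(f \<longlongrightarrow> 0) at_infinity"
  shows "apply_c0 (c0_of f) = f"
proof -
  have "eventually (\<lambda>s. norm (f s) < 1) at_infinity"
    using tendstoD[OF lim, of 1] by simp
  then obtain b where b: "\<And>s. b \<le> norm s \<Longrightarrow> norm (f s) < 1"
    unfolding eventually_at_infinity by blast
  have "compact (f ` {-b..b})"
    by (intro compact_continuous_image continuous_on_subset[OF cont]) auto
  then obtain c where c: "\<And>s. s \<in> {-b..b} \<Longrightarrow> norm (f s) \<le> c"
    by (meson bounded_iff compact_imp_bounded imageI)
  have "norm (f s) \<le> max 1 c" for s
  proof (cases "b \<le> norm s")
    case True
    then show ?thesis using b[of s] by simp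
  next
    case False
    then have "s \<in> {-b..b}" by (auto simp: abs_real_def split: if_splits)
    then show ?thesis using c[of s] by simp
  qed
  then have "f \<in> bcontfun"
    using cont by (rule bcontfun_normI[rotated])
  then have "apply_bcontfun (Bcontfun f) = f"
    by (rule Bcontfun_inverse)
  with lim show ?thesis
    unfolding apply_c0_def c0_of_def by (subst Abs_c0_inverse) auto
qed

lemma range_apply_c0:
  "range (apply_c0 :: 'a::real_normed_vector c0 \<Rightarrow> _) =
    {f. continuous_on UNIV f \<and> (f \<longlongrightarrow> 0) at_infinity}"
proof (intro equalityI subsetI)
  fix f :: "real \<Rightarrow> 'a" assume "f \<in> {f. continuous_on UNIV f \<and> (f \<longlongrightarrow> 0) at_infinity}"
  then have "f = apply_c0 (c0_of f)" by (simp add: apply_c0_of)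
  then show "f \<in> range apply_c0" by (rule range_eqI)
qed (auto simp: continuous_apply_c0 tendsto_apply_c0)

lemma norm_c0_SUP: "norm u = (SUP s. norm (apply_c0 u s))"
  unfolding norm_c0.rep_eq apply_c0_def norm_bcontfun_def dist_bcontfun.rep_eq by simp

lemma apply_c0_simps [simp]:
  "apply_c0 0 s = 0"
  "apply_c0 (u + v) s = apply_c0 u s + apply_c0 v s"
  "apply_c0 (u - v) s = apply_c0 u s - apply_c0 v s"
  "apply_c0 (- u) s = - apply_c0 u s"
  "apply_c0 (r *\<^sub>R u) s = r *\<^sub>R apply_c0 u s"
  by (simp_all add: apply_c0_def zero_c0.rep_eq plus_c0.rep_eq minus_c0.rep_eq
      uminus_c0.rep_eq scaleR_c0.rep_eq)

instance c0 :: (banach) banach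
proof
  fix X :: "nat \<Rightarrow> 'a c0"
  assume "Cauchy X"
  then have "Cauchy (\<lambda>n. Rep_c0 (X n))"
    by (simp add: Cauchy_def dist_c0.rep_eq)
  then obtain l where l: "(\<lambda>n. Rep_c0 (X n)) \<longlonglongrightarrow> l"
    using Cauchy_convergent convergent_def by blast
  have "(apply_bcontfun l \<longlongrightarrow> 0) at_infinity"
  proof (rule tendstoI)
    fix e :: real assume "0 < e"
    then have "\<forall>\<^sub>F n in sequentially. dist (Rep_c0 (X n)) l < e / 2"
      by (intro tendstoD[OF l]) simp
    then obtain n where n: "dist (Rep_c0 (X n)) l < e / 2"
      using eventually_happens by fastforce
    have "\<forall>\<^sub>F s in at_infinity. dist (apply_bcontfun (Rep_c0 (X n)) s) 0 < e / 2"
      using Rep_c0[of "X n"] \<open>0 < e\<close> by (auto dest: tendstoD[where e = "e / 2"])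
    then show "\<forall>\<^sub>F s in at_infinity. dist (apply_bcontfun l s) 0 < e"
    proof eventually_elim
      case (elim s)
      have "dist (apply_bcontfun (Rep_c0 (X n)) s) (apply_bcontfun l s) < e / 2"
        using n by (rule dist_fun_lt_imp_dist_val_lt)
      with elim show ?case
        by (metis dist_commute dist_triangle_half_l)
    qed
  qed
  then obtain L where "l = Rep_c0 L"
    by (metis (mono_tags, lifting) Rep_c0_cases mem_Collect_eq)
  with l have "X \<longlonglongrightarrow> L"
    by (simp add: tendsto_iff dist_c0.rep_eq)
  then show "convergent X"
    by (rule convergentI)
qed

definition c0_scale :: "('k \<Rightarrow> 'a \<Rightarrow> 'a) \<Rightarrow> 'k \<Rightarrow> 'a::real_normed_vector c0 \<Rightarrow> 'a c0" where
  "c0_scale smul c u = c0_of (\<lambda>s. smul c (apply_c0 u s))"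

context normed_scaling
begin

lemma bounded_linear_scale: "bounded_linear (smul c)"
proof (rule bounded_linear_intro)
  fix x y and r :: real
  show "smul c (x + y) = smul c x + smul c y" by (rule scale_right_distrib)
  show "smul c (r *\<^sub>R x) = r *\<^sub>R smul c x"
    by (simp add: mult.commute flip: scale_of_real)
  show "norm (smul c x) \<le> norm x * norm c" by (simp add: norm_scale)
qed

lemma apply_c0_scale: "apply_c0 (c0_scale smul c u) s = smul c (apply_c0 u s)"
proof -
  have "continuous_on UNIV (\<lambda>s. smul c (apply_c0 u s))"
    by (intro bounded_linear.continuous_on[OF bounded_linear_scale] continuous_apply_c0)
  moreover have "((\<lambda>s. smul c (apply_c0 u s)) \<longlongrightarrow> 0) at_infinity"
    by (rule bounded_linear.tendsto_zero[OF bounded_linear_scale tendsto_apply_c0])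
  ultimately show ?thesis
    by (simp add: c0_scale_def apply_c0_of)
qed

lemma normed_scaling_c0: "normed_scaling (c0_scale smul)"
proof
  fix a b c :: 'k and u v :: "'a c0" and r :: real
  show "c0_scale smul a (u + v) = c0_scale smul a u + c0_scale smul a v"
    by (rule c0_eqI) (simp add: apply_c0_scale scale_right_distrib)
  show "c0_scale smul (a + b) u = c0_scale smul a u + c0_scale smul b u"
    by (rule c0_eqI) (simp add: apply_c0_scale scale_left_distrib)
  show "c0_scale smul a (c0_scale smul b u) = c0_scale smul (a * b) u"
    by (rule c0_eqI) (simp add: apply_c0_scale)
  show "c0_scale smul 1 u = u"
    by (rule c0_eqI) (simp add: apply_c0_scale)
  show "c0_scale smul (of_real r) u = r *\<^sub>R u"
    by (rule c0_eqI) (simp add: apply_c0_scale scale_of_real)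
  have bdd: "bdd_above (range (\<lambda>s. norm (apply_c0 u s)))"
    by (rule bdd_aboveI[of _ "norm u"]) (auto simp: apply_c0_def norm_c0.rep_eq norm_bounded)
  have "(SUP s. norm c * norm (apply_c0 u s)) = norm c * (SUP s. norm (apply_c0 u s))"
    using continuous_at_Sup_mono[of "\<lambda>x. norm c * x" "range (\<lambda>s. norm (apply_c0 u s))"] bdd
    by (simp add: image_comp o_def monoI mult_left_mono continuous_intros)
  then show "norm (c0_scale smul c u) = norm c * norm u"
    by (simp add: norm_c0_SUP apply_c0_scale norm_scale)
qed

end


subsection \<open>Semigroups, generators and spectra\<close>

definition C0_semigroup ::
    "('k::real_normed_field \<Rightarrow> 'b::real_normed_vector \<Rightarrow> 'b) \<Rightarrow> (real \<Rightarrow> 'b \<Rightarrow> 'b) \<Rightarrow> bool" where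
  "C0_semigroup smul T \<longleftrightarrow>
    (\<forall>t\<ge>0. bounded_operator smul (T t)) \<and>
    T 0 = id \<and>
    (\<forall>t\<ge>0. \<forall>s\<ge>0. T (t + s) = T t \<circ> T s) \<and>
    (\<forall>x. ((\<lambda>t. T t x) \<longlongrightarrow> x) (at_right 0))"

definition generator_domain :: "(real \<Rightarrow> 'b::real_normed_vector \<Rightarrow> 'b) \<Rightarrow> 'b set" where
  "generator_domain T = {x. \<exists>y. ((\<lambda>t. (T t x - x) /\<^sub>R t) \<longlongrightarrow> y) (at_right 0)}"

text \<open>Unspecified outside \<^const>\<open>generator_domain\<close>.\<close>

definition generator :: "(real \<Rightarrow> 'b::real_normed_vector \<Rightarrow> 'b) \<Rightarrow> 'b \<Rightarrow> 'b" where
  "generator T x = Lim (at_right 0) (\<lambda>t. (T t x - x) /\<^sub>R t)"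

text \<open>An unbounded operator is given by its domain \<open>D\<close> and a function \<open>A\<close> that matters only on \<open>D\<close>.\<close>

definition resolvent_set ::
    "('k::real_normed_field \<Rightarrow> 'b::real_normed_vector \<Rightarrow> 'b) \<Rightarrow> 'b set \<Rightarrow> ('b \<Rightarrow> 'b) \<Rightarrow> 'k set" where
  "resolvent_set smul D A =
    {c. bij_betw (\<lambda>x. smul c x - A x) D UNIV \<and>
        bounded_linear (inv_into D (\<lambda>x. smul c x - A x))}"

definition spectrum ::
    "('k::real_normed_field \<Rightarrow> 'b::real_normed_vector \<Rightarrow> 'b) \<Rightarrow> 'b set \<Rightarrow> ('b \<Rightarrow> 'b) \<Rightarrow> 'k set" where
  "spectrum smul D A = - resolvent_set smul D A"


subsection \<open>Evolution families and evolution semigroups\<close>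

definition A_infinity :: "(real \<Rightarrow> real) set" where
  "A_infinity = {\<mu>. continuous_on UNIV \<mu> \<and> strict_mono \<mu> \<and>
    filterlim \<mu> at_bot at_bot \<and> filterlim \<mu> at_top at_top}"

text \<open>The values \<open>U t s\<close> with \<open>t < s\<close> are irrelevant.\<close>

definition evolution_family ::
    "('k::real_normed_field \<Rightarrow> 'a::real_normed_vector \<Rightarrow> 'a) \<Rightarrow> (real \<Rightarrow> real \<Rightarrow> 'a \<Rightarrow>\<^sub>L 'a) \<Rightarrow> bool" where
  "evolution_family smul U \<longleftrightarrow>
    (\<forall>t s. s \<le> t \<longrightarrow> bounded_operator smul (blinfun_apply (U t s))) \<and>
    (\<forall>t. U t t = id_blinfun) \<and>
    (\<forall>t \<tau> t0. t0 \<le> \<tau> \<and> \<tau> \<le> t \<longrightarrow> U t \<tau> o\<^sub>L U \<tau> t0 = U t t0) \<and>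
    (\<forall>x. continuous_on {(t, s). s \<le> t} (\<lambda>(t, s). blinfun_apply (U t s) x))"

definition gen_evolution_semigroup ::
    "(real \<Rightarrow> real) \<Rightarrow> (real \<Rightarrow> real \<Rightarrow> 'a \<Rightarrow>\<^sub>L 'a) \<Rightarrow> real \<Rightarrow> 'a::real_normed_vector c0 \<Rightarrow> 'a c0" where
  "gen_evolution_semigroup \<mu> U t u =
    c0_of (\<lambda>s. blinfun_apply (U s (inv \<mu> (\<mu> s - t))) (apply_c0 u (inv \<mu> (\<mu> s - t))))"

definition evolution_semigroup ::
    "(real \<Rightarrow> real \<Rightarrow> 'a \<Rightarrow>\<^sub>L 'a) \<Rightarrow> real \<Rightarrow> 'a::real_normed_vector c0 \<Rightarrow> 'a c0" where
  "evolution_semigroup V t v =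
    c0_of (\<lambda>s. blinfun_apply (V s (s - t)) (apply_c0 v (s - t)))"

definition c0_compose :: "(real \<Rightarrow> real) \<Rightarrow> 'a::real_normed_vector c0 \<Rightarrow> 'a c0" where
  "c0_compose h u = c0_of (apply_c0 u \<circ> h)"

end

theory Submission
  imports Defs
begin

text \<open>
  Substituting \<open>\<mu>\<close> in the time variable turns the growth bound of \<open>U\<close> into the ordinary exponential
  bound of \<open>V\<close>, and the formula of \<open>T\<close> into that of \<open>F\<^sup>-\<^sup>1 S F\<close>. Hence only \<open>S\<close> needs analysis:
  strong continuity at \<open>0\<close> follows on compact intervals from the uniform continuity of
  \<open>(t, s) \<mapsto> V(s, s - t) v(s - t)\<close>, and outside of them from \<open>v\<close> being small there. Generators and
  spectra are carried over by similarity.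
\<close>

section \<open>Norm bounds in \<open>c0\<close> and bounded operators over the scalar field\<close>

lemma norm_apply_c0_le: "norm (apply_c0 u s) \<le> norm u"
  by (simp add: apply_c0_def norm_c0.rep_eq norm_bounded)

lemma norm_c0_leI: "(\<And>s. norm (apply_c0 u s) \<le> b) \<Longrightarrow> norm u \<le> b"
  unfolding norm_c0_SUP by (rule cSUP_least) auto

text \<open>Through \<open>scale_of_real\<close>, homogeneity over the scalar field contains real
  homogeneity, so a single scaling law serves both halves of
  \<open>bounded_operator\<close>.\<close>

lemma bounded_operator_intro:
  assumes "normed_scaling smul"
    and add: "\<And>x y. f (x + y) = f x + f y"
    and scale: "\<And>c x. f (smul c x) = smul c (f x)"
    and bound: "\<And>x. norm (f x) \<le> norm x * M"
  shows "bounded_operator smul f"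
proof -
  interpret normed_scaling smul by fact
  have "bounded_linear f"
    by (rule bounded_linear_intro[OF add _ bound]) (simp flip: scale_of_real add: scale)
  moreover have "Vector_Spaces.linear smul smul f"
    by unfold_locales (rule add scale)+
  ultimately show ?thesis by (simp add: bounded_operator_def)
qed

lemma bounded_operatorD:
  assumes "bounded_operator smul f"
  shows "bounded_linear f" "f (smul c x) = smul c (f x)"
proof -
  show "bounded_linear f" using assms by (simp add: bounded_operator_def)
  interpret Vector_Spaces.linear smul smul f using assms by (simp add: bounded_operator_def)
  show "f (smul c x) = smul c (f x)" by (rule scale)
qed

lemma bounded_operator_compose:
  assumes "bounded_operator smul f" "bounded_operator smul g"
  shows "bounded_operator smul (g \<circ> f)"
  using assms bounded_linear_compose[of g f] Vector_Spaces.linear_compose[of smul smul f smul g]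
  by (simp add: bounded_operator_def o_def)


subsection \<open>Similar semigroups\<close>

lemma C0_semigroup_similar:
  assumes S: "C0_semigroup smul S"
    and P: "bounded_operator smul P" and Q: "bounded_operator smul Q"
    and PQ: "P \<circ> Q = id" and QP: "Q \<circ> P = id"
    and T: "\<And>t. t \<ge> 0 \<Longrightarrow> T t = Q \<circ> S t \<circ> P"
  shows "C0_semigroup smul T"
proof -
  have PQ': "P (Q x) = x" and QP': "Q (P x) = x" for x
    using PQ QP by (simp_all add: fun_eq_iff)
  have "((\<lambda>t. T t x) \<longlongrightarrow> x) (at_right 0)" for x
  proof -
    have "((\<lambda>t. Q (S t (P x))) \<longlongrightarrow> Q (P x)) (at_right 0)"
      using S by (intro bounded_linear.tendsto[OF bounded_operatorD(1)[OF Q]])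
        (simp add: C0_semigroup_def)
    \<comment> \<open>\<open>T\<close> is tied to \<open>S\<close> only at nonnegative times, and
      these are all that the filter \<open>at_right 0\<close> sees.\<close>
    moreover have "\<forall>\<^sub>F t in at_right 0. Q (S t (P x)) = T t x"
      using T by (auto simp: eventually_at_right_field intro: exI[of _ 1])
    ultimately show ?thesis
      by (simp add: QP' tendsto_cong)
  qed
  moreover have "bounded_operator smul (T t)" if "0 \<le> t" for t
    unfolding T[OF that] using S P Q that
    by (intro bounded_operator_compose) (simp_all add: C0_semigroup_def)
  moreover have "T 0 = id" "\<And>t s. 0 \<le> t \<Longrightarrow> 0 \<le> s \<Longrightarrow> T (t + s) = T t \<circ> T s"
    using S by (auto simp: C0_semigroup_def T PQ' QP')
  ultimately show ?thesis
    by (simp add: C0_semigroup_def)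
qed

text \<open>Being linear and continuous, \<open>P\<close> passes through the difference quotient and
  then through its limit.\<close>

lemma generator_quotient_intertwine:
  fixes P :: "'b::real_normed_vector \<Rightarrow> 'c::real_normed_vector"
  assumes P: "bounded_linear P"
    and PT: "\<And>t. t > 0 \<Longrightarrow> P (T t x) = S t (P x)"
    and lim: "((\<lambda>t. (T t x - x) /\<^sub>R t) \<longlongrightarrow> y) (at_right 0)"
  shows "((\<lambda>t. (S t (P x) - P x) /\<^sub>R t) \<longlongrightarrow> P y) (at_right 0)"
proof -
  interpret bounded_linear P by fact
  have "((\<lambda>t. P ((T t x - x) /\<^sub>R t)) \<longlongrightarrow> P y) (at_right 0)"
    using lim by (rule tendsto)
  moreover have "\<forall>\<^sub>F t in at_right 0. P ((T t x - x) /\<^sub>R t) = (S t (P x) - P x) /\<^sub>R t"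
    using PT by (auto simp: eventually_at_right_field scale diff intro: exI[of _ 1])
  ultimately show ?thesis by (simp add: tendsto_cong)
qed

lemma generator_eqI:
  assumes "((\<lambda>t. (T t x - x) /\<^sub>R t) \<longlongrightarrow> y) (at_right 0)"
  shows "x \<in> generator_domain T" "generator T x = y"
  using assms by (auto simp: generator_domain_def generator_def intro: tendsto_Lim)

lemma generator_tendsto:
  assumes "x \<in> generator_domain T"
  shows "((\<lambda>t. (T t x - x) /\<^sub>R t) \<longlongrightarrow> generator T x) (at_right 0)"
  using assms generator_eqI(2) by (fastforce simp: generator_domain_def)

text \<open>An intertwining operator gives one inclusion between the domains. Applied to
  \<open>P\<close> and to its inverse \<open>Q\<close>, it gives equality in
  \<open>generator_similar\<close>.\<close>

lemma generator_intertwine: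
  fixes P :: "'b::real_normed_vector \<Rightarrow> 'c::real_normed_vector"
  assumes P: "bounded_linear P"
    and PT: "\<And>t x. t > 0 \<Longrightarrow> P (T t x) = S t (P x)"
    and x: "x \<in> generator_domain T"
  shows "P x \<in> generator_domain S" "generator S (P x) = P (generator T x)"
  using generator_quotient_intertwine[of P T x S, OF P PT generator_tendsto[OF x]]
  by (auto intro: generator_eqI)

text \<open>On \<open>D\<close> the operator \<open>c - A\<close> factors as
  \<open>Q (c - B) P\<close>, so a bounded inverse \<open>R\<close> of \<open>c - B\<close> yields
  the bounded inverse \<open>Q R P\<close> of \<open>c - A\<close>. The reverse inclusion comes from
  exchanging the roles of the two operators.\<close>

lemma resolvent_set_similar_subset:
  assumes P: "bounded_operator smul P" and Q: "bounded_operator smul Q"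
    and PQ: "P \<circ> Q = id" and QP: "Q \<circ> P = id"
    and D: "D = {x. P x \<in> E}" and A: "\<And>x. x \<in> D \<Longrightarrow> A x = Q (B (P x))"
  shows "resolvent_set smul E B \<subseteq> resolvent_set smul D A"
proof
  fix c assume "c \<in> resolvent_set smul E B"
  then have bij: "bij_betw (\<lambda>x. smul c x - B x) E UNIV"
    and bdd: "bounded_linear (inv_into E (\<lambda>x. smul c x - B x))"
    by (simp_all add: resolvent_set_def)
  let ?b = "\<lambda>x. smul c x - B x" and ?a = "\<lambda>x. smul c x - A x"
  have PQ': "P (Q x) = x" and QP': "Q (P x) = x" for x
    using PQ QP by (simp_all add: fun_eq_iff)
  interpret Q: bounded_linear Q by (rule bounded_operatorD(1)[OF Q])
  \<comment> \<open>Both \<open>P\<close> and \<open>Q\<close> commute with scalars and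
    \<open>Q (P x) = x\<close>, so \<open>smul c x = Q (smul c (P x))\<close>.\<close>
  have a: "?a x = Q (?b (P x))" if "x \<in> D" for x
    using that by (simp add: A Q.diff bounded_operatorD(2)[OF P] bounded_operatorD(2)[OF Q] QP'
        flip: bounded_operatorD(2)[OF P])
  have "bij_betw P D E"
    by (rule bij_betw_byWitness[of _ Q]) (auto simp: D PQ' QP')
  moreover have "bij_betw Q UNIV UNIV"
    by (rule bij_betw_byWitness[of _ P]) (auto simp: PQ' QP')
  ultimately have "bij_betw (Q \<circ> (?b \<circ> P)) D UNIV"
    by (blast intro: bij_betw_trans bij)
  then have bij_a: "bij_betw ?a D UNIV"
    by (subst bij_betw_cong[of D _ "Q \<circ> (?b \<circ> P)"]) (auto simp: a)
  \<comment> \<open>Since \<open>?a\<close> is injective on \<open>D\<close>, it is enough that the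
    candidate lies in \<open>D\<close> and is mapped to \<open>y\<close>.\<close>
  have "inv_into D ?a y = Q (inv_into E ?b (P y))" for y
  proof (rule inv_into_f_eq)
    show "inj_on ?a D" using bij_a by (rule bij_betw_imp_inj_on)
    have "inv_into E ?b (P y) \<in> E" "?b (inv_into E ?b (P y)) = P y"
      using bij by (metis bij_betw_imp_surj_on iso_tuple_UNIV_I inv_into_into,
          metis (no_types, lifting) bij_betw_inv_into_right iso_tuple_UNIV_I)
    then show "Q (inv_into E ?b (P y)) \<in> D" "?a (Q (inv_into E ?b (P y))) = y"
      by (simp_all add: D PQ' QP' a)
  qed
  then have "inv_into D ?a = (\<lambda>y. Q (inv_into E ?b (P y)))" by (rule ext)
  then have "bounded_linear (inv_into D ?a)"
    using bounded_linear_compose[OF Q.bounded_linear_axioms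
        bounded_linear_compose[OF bdd bounded_operatorD(1)[OF P]]] by simp
  with bij_a show "c \<in> resolvent_set smul D A" by (simp add: resolvent_set_def)
qed

lemma generator_similar:
  assumes P: "bounded_operator smul P" and Q: "bounded_operator smul Q"
    and PQ: "P \<circ> Q = id" and QP: "Q \<circ> P = id"
    and T: "\<And>t. t \<ge> 0 \<Longrightarrow> T t = Q \<circ> S t \<circ> P"
  shows generator_domain_similar: "generator_domain T = {x. P x \<in> generator_domain S}"
    and generator_eq_similar: "x \<in> generator_domain T \<Longrightarrow> generator T x = Q (generator S (P x))"
    and spectrum_similar: "spectrum smul (generator_domain T) (generator T) =
      spectrum smul (generator_domain S) (generator S)"
proof -
  have PQ': "P (Q x) = x" and QP': "Q (P x) = x" for x
    using PQ QP by (simp_all add: fun_eq_iff)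
  have PT: "P (T t x) = S t (P x)" and QS: "Q (S t x) = T t (Q x)" if "t > 0" for t x
    using that by (simp_all add: T PQ' QP')
  note P_lin = bounded_operatorD(1)[OF P] and Q_lin = bounded_operatorD(1)[OF Q]
  note TS = generator_intertwine[of P T S, OF P_lin PT]
    and ST = generator_intertwine[of Q S T, OF Q_lin QS]
  show dom_T: "generator_domain T = {x. P x \<in> generator_domain S}"
    using TS(1) ST(1) QP' by (metis (no_types, lifting) Collect_cong Collect_mem_eq)
  \<comment> \<open>The same relation read backwards, as needed for the resolvent inclusion with
    \<open>P\<close> and \<open>Q\<close> exchanged.\<close>
  have dom_S: "generator_domain S = {x. Q x \<in> generator_domain T}"
    using dom_T by (simp add: PQ')
  have gen_T: "generator T x = Q (generator S (P x))" if "x \<in> generator_domain T" for x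
    using TS(2)[OF _ that] by (simp add: QP')
  then show "x \<in> generator_domain T \<Longrightarrow> generator T x = Q (generator S (P x))" .
  have gen_S: "generator S x = P (generator T (Q x))" if "x \<in> generator_domain S" for x
    using ST(2)[OF _ that] by (simp add: PQ')
  have "resolvent_set smul (generator_domain T) (generator T) =
      resolvent_set smul (generator_domain S) (generator S)"
    using resolvent_set_similar_subset[where A = "generator T" and B = "generator S",
        OF P Q PQ QP dom_T gen_T]
      resolvent_set_similar_subset[where A = "generator S" and B = "generator T",
        OF Q P QP PQ dom_S gen_S] by blast
  then show "spectrum smul (generator_domain T) (generator T) =
      spectrum smul (generator_domain S) (generator S)"
    by (simp add: spectrum_def)
qed


subsection \<open>Changes of the time variable\<close>

text \<open>For a strictly increasing function, continuity together with the two limits amounts to a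
  range without gaps or ends. This order-theoretic form passes to the inverse function at
  once.\<close>

lemma A_infinity_iff: "\<mu> \<in> A_infinity \<longleftrightarrow> strict_mono \<mu> \<and> surj \<mu>"
proof
  assume \<mu>: "\<mu> \<in> A_infinity"
  then have cont: "continuous_on UNIV \<mu>" and mono: "strict_mono \<mu>"
    and bot: "filterlim \<mu> at_bot at_bot" and top: "filterlim \<mu> at_top at_top"
    by (auto simp: A_infinity_def)
  have "\<exists>x. \<mu> x = y" for y
  proof -
    obtain a where a: "\<mu> a \<le> y"
      using bot unfolding filterlim_at_bot eventually_at_bot_linorder by blast
    obtain b where b: "y \<le> \<mu> b"
      using top unfolding filterlim_at_top eventually_at_top_linorder by blast
    have "\<mu> a \<le> \<mu> b" using a b by simp
    then have "a \<le> b" using mono by (simp add: strict_mono_less_eq)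
    then show ?thesis
      using IVT'[of \<mu> a y b] a b continuous_on_subset[OF cont] by blast
  qed
  with mono show "strict_mono \<mu> \<and> surj \<mu>" by (metis surjI)
next
  assume \<mu>: "strict_mono \<mu> \<and> surj \<mu>"
  then have le: "\<mu> x \<le> \<mu> y \<longleftrightarrow> x \<le> y" for x y by (simp add: strict_mono_less_eq)
  \<comment> \<open>An increasing map is continuous once its image is open; here the image is the
    whole line.\<close>
  have "continuous_on UNIV \<mu>"
    by (rule continuous_onI_mono) (use \<mu> le in auto)
  moreover have "filterlim \<mu> at_bot at_bot"
    unfolding filterlim_at_bot eventually_at_bot_linorder using \<mu> le by (metis surjD)
  moreover have "filterlim \<mu> at_top at_top"
    unfolding filterlim_at_top eventually_at_top_linorder using \<mu> le by (metis surjD)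
  ultimately show "\<mu> \<in> A_infinity" using \<mu> by (simp add: A_infinity_def)
qed

lemma A_infinity_inv:
  assumes "\<mu> \<in> A_infinity"
  shows "inv \<mu> \<in> A_infinity"
proof -
  have \<mu>: "strict_mono \<mu>" "bij \<mu>"
    using assms by (auto simp: A_infinity_iff bij_def strict_mono_imp_inj_on)
  then have "strict_mono (inv \<mu>)"
    by (intro strict_monoI) (metis bij_inv_eq_iff strict_mono_less)
  with \<mu> show ?thesis by (simp add: A_infinity_iff bij_imp_bij_inv bij_is_surj)
qed

text \<open>This is why composition with \<open>\<mu>\<close> preserves decay at infinity and so
  stays inside \<open>c0\<close>.\<close>

lemma A_infinity_filterlim_at_infinity:
  assumes "\<mu> \<in> A_infinity"
  shows "filterlim \<mu> at_infinity at_infinity"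
proof -
  have "filterlim \<mu> at_infinity at_bot" "filterlim \<mu> at_infinity at_top"
    using assms by (auto simp: A_infinity_def intro: filterlim_at_bot_imp_at_infinity
        filterlim_at_top_imp_at_infinity)
  then show ?thesis by (simp add: at_infinity_eq_at_top_bot filterlim_sup)
qed

lemma apply_c0_compose:
  fixes u :: "'a::real_normed_vector c0"
  assumes "\<mu> \<in> A_infinity"
  shows "apply_c0 (c0_compose \<mu> u) = apply_c0 u \<circ> \<mu>"
  unfolding c0_compose_def
proof (rule apply_c0_of)
  show "continuous_on UNIV (apply_c0 u \<circ> \<mu>)"
    using assms by (intro continuous_on_compose continuous_apply_c0) (simp add: A_infinity_def)
  show "((apply_c0 u \<circ> \<mu>) \<longlongrightarrow> 0) at_infinity"
    unfolding o_def
    by (rule filterlim_compose[OF tendsto_apply_c0 A_infinity_filterlim_at_infinity[OF assms]])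
qed

text \<open>Composition on the right cannot enlarge a supremum, whence the bound 1.\<close>

lemma bounded_operator_c0_compose:
  fixes smul :: "'k::real_normed_field \<Rightarrow> 'a::real_normed_vector \<Rightarrow> 'a"
  assumes "normed_scaling smul" and \<mu>: "\<mu> \<in> A_infinity"
  shows "bounded_operator (c0_scale smul) (c0_compose \<mu>)"
proof -
  interpret normed_scaling smul by fact
  show ?thesis
  proof (rule bounded_operator_intro[OF normed_scaling_c0])
    show "norm (c0_compose \<mu> u) \<le> norm u * 1" for u :: "'a c0"
      by (rule norm_c0_leI) (simp add: apply_c0_compose \<mu> norm_apply_c0_le)
  qed (rule c0_eqI; simp add: apply_c0_compose \<mu> apply_c0_scale)+
qed


subsection \<open>Exponentially bounded evolution families\<close>

lemma evolution_familyD: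
  assumes "evolution_family smul V"
  shows "s \<le> t \<Longrightarrow> V t s (smul c x) = smul c (V t s x)"
    and "V t t = id_blinfun"
    and "r \<le> s \<Longrightarrow> s \<le> t \<Longrightarrow> V t s (V s r x) = V t r x"
    and "continuous_on {(t, s). s \<le> t} (\<lambda>(t, s). V t s x)"
proof -
  show "V t s (smul c x) = smul c (V t s x)" if "s \<le> t"
    using assms that unfolding evolution_family_def by (metis bounded_operatorD(2))
  show "V t s (V s r x) = V t r x" if "r \<le> s" "s \<le> t"
    using assms that unfolding evolution_family_def by (metis blinfun_apply_blinfun_compose)
qed (use assms in \<open>simp_all add: evolution_family_def\<close>)

text \<open>A monotone \<open>h\<close> maps pairs with \<open>s \<le> t\<close> to such pairs, so
  every law of \<open>U\<close> can be read at the new times.\<close>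

lemma evolution_family_reparametrize:
  assumes U: "evolution_family smul U" and h: "mono h" "continuous_on UNIV h"
  shows "evolution_family smul (\<lambda>t s. U (h t) (h s))"
proof -
  have "continuous_on {(t, s). s \<le> t} (\<lambda>(t, s). U (h t) (h s) x)" for x
  proof -
    have "continuous_on {(t, s). s \<le> t} (\<lambda>p. (\<lambda>(t, s). U t s x) (h (fst p), h (snd p)))"
      by (rule continuous_on_compose2[OF evolution_familyD(4)[OF U]])
        (use h in \<open>auto intro!: continuous_intros continuous_on_compose2[OF h(2)] simp: mono_def\<close>)
    then show ?thesis by (simp add: case_prod_beta)
  qed
  with U show ?thesis
    unfolding evolution_family_def using monoD[OF h(1)] by simp
qed

text \<open>Strong continuity controls \<open>B p\<close> on a fixed vector only; the uniform norm
  bound lets the vector move as well. The splitting is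
  \<open>B p (w p) = B p (w p - w q) + B p (w q)\<close>.\<close>

lemma continuous_on_blinfun_apply_strong:
  fixes B :: "'p::topological_space \<Rightarrow> 'a::real_normed_vector \<Rightarrow>\<^sub>L 'b::real_normed_vector"
  assumes B: "\<And>x. continuous_on P (\<lambda>p. B p x)"
    and M: "\<And>p. p \<in> P \<Longrightarrow> norm (B p) \<le> M"
    and w: "continuous_on P w"
  shows "continuous_on P (\<lambda>p. B p (w p))"
  unfolding continuous_on_def
proof
  fix q assume q: "q \<in> P"
  have "((\<lambda>p. B p (w p - w q)) \<longlongrightarrow> 0) (at q within P)"
  proof (rule tendsto_0_le[where K = M])
    show "((\<lambda>p. w p - w q) \<longlongrightarrow> 0) (at q within P)"
      using w q by (simp add: continuous_on_def LIM_zero)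
    show "\<forall>\<^sub>F p in at q within P. norm (B p (w p - w q)) \<le> norm (w p - w q) * M"
      unfolding eventually_at_topological
    proof (intro exI[of _ UNIV] conjI ballI impI)
      fix p assume "p \<in> P"
      then show "norm (B p (w p - w q)) \<le> norm (w p - w q) * M"
        by (metis M norm_blinfun order_trans mult.commute mult_left_mono norm_ge_zero)
    qed auto
  qed
  moreover have "((\<lambda>p. B p (w q)) \<longlongrightarrow> B q (w q)) (at q within P)"
    using B q by (simp add: continuous_on_def)
  ultimately have "((\<lambda>p. B p (w p - w q) + B p (w q)) \<longlongrightarrow> 0 + B q (w q)) (at q within P)"
    by (rule tendsto_add)
  then show "((\<lambda>p. B p (w p)) \<longlongrightarrow> B q (w q)) (at q within P)"
    by (simp flip: blinfun.add_right)
qed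

section \<open>The evolution semigroup of an exponentially bounded family\<close>

locale exp_bounded_evolution_family = normed_scaling smul
  for smul :: "'k::real_normed_field \<Rightarrow> 'a::real_normed_vector \<Rightarrow> 'a" +
  fixes V :: "real \<Rightarrow> real \<Rightarrow> 'a \<Rightarrow>\<^sub>L 'a" and K \<alpha> :: real
  assumes evolution_family: "evolution_family smul V"
    and norm_le: "s \<le> t \<Longrightarrow> norm (V t s) \<le> K * exp (\<alpha> * (t - s))"
begin

lemmas evol = evolution_familyD[OF evolution_family]

lemma K_nonneg: "0 \<le> K"
  using norm_le[of 0 0] norm_ge_zero[of "V 0 0"] by (simp del: norm_ge_zero)

lemma norm_le_uniform:
  assumes "0 \<le> t" "t \<le> c"
  shows "norm (V s (s - t)) \<le> K * exp (\<bar>\<alpha>\<bar> * c)"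
proof -
  \<comment> \<open>The absolute value makes the bound increase with time whatever the sign of
    \<open>\<alpha>\<close>, so that time \<open>c\<close> dominates.\<close>
  have "\<alpha> * t \<le> \<bar>\<alpha>\<bar> * c" using assms by (intro mult_mono) auto
  then have "K * exp (\<alpha> * t) \<le> K * exp (\<bar>\<alpha>\<bar> * c)"
    by (intro mult_left_mono K_nonneg) simp
  then show ?thesis using norm_le[of "s - t" s] assms by simp
qed

lemma norm_apply_le_uniform:
  assumes "0 \<le> t" "t \<le> c"
  shows "norm (V s (s - t) x) \<le> norm x * (K * exp (\<bar>\<alpha>\<bar> * c))"
  using norm_blinfun[of "V s (s - t)" x] mult_left_mono[OF norm_le_uniform[OF assms, of s], of "norm x"]
  by (simp add: mult.commute)

text \<open>Elapsed time is cut off at \<open>c\<close> to give the operators the common norm bound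
  that \<open>continuous_on_blinfun_apply_strong\<close> asks for.\<close>

lemma continuous_on_evolution:
  "continuous_on ({0..c} \<times> UNIV) (\<lambda>(t, s). V s (s - t) (apply_c0 v (s - t)))"
  unfolding case_prod_beta
proof (rule continuous_on_blinfun_apply_strong)
  fix x
  have "continuous_on ({0..c} \<times> UNIV) (\<lambda>p::real \<times> real. (\<lambda>(t, s). V t s x) (snd p, snd p - fst p))"
    by (rule continuous_on_compose2[OF evol(4)]) (auto intro!: continuous_intros)
  then show "continuous_on ({0..c} \<times> UNIV) (\<lambda>p. V (snd p) (snd p - fst p) x)" by simp
  show "continuous_on ({0..c} \<times> UNIV) (\<lambda>p. apply_c0 v (snd p - fst p))"
    by (rule continuous_on_compose2[OF continuous_apply_c0]) (auto intro!: continuous_intros)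
qed (auto intro: norm_le_uniform)

lemma apply_evolution_semigroup:
  assumes t: "0 \<le> t"
  shows "apply_c0 (evolution_semigroup V t v) s = V s (s - t) (apply_c0 v (s - t))"
proof -
  \<comment> \<open>The slice at fixed time \<open>t\<close> of the joint continuity, taken with
    \<open>c = t\<close>.\<close>
  have "continuous_on UNIV (\<lambda>s. (\<lambda>(t, s). V s (s - t) (apply_c0 v (s - t))) (t, s))"
    by (rule continuous_on_compose2[OF continuous_on_evolution[of t v]])
      (use t in \<open>auto intro!: continuous_intros\<close>)
  moreover have "((\<lambda>s. V s (s - t) (apply_c0 v (s - t))) \<longlongrightarrow> 0) at_infinity"
  proof (rule tendsto_0_le[where K = "K * exp (\<bar>\<alpha>\<bar> * t)"])
    have "(\<lambda>s. s - t) \<in> A_infinity"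
      by (auto simp: A_infinity_iff strict_mono_def intro: surjI[of _ "\<lambda>s. s + t"])
    then show "((\<lambda>s. apply_c0 v (s - t)) \<longlongrightarrow> 0) at_infinity"
      by (intro filterlim_compose[OF tendsto_apply_c0] A_infinity_filterlim_at_infinity)
  qed (use t in \<open>simp add: norm_apply_le_uniform\<close>)
  ultimately show ?thesis by (simp add: evolution_semigroup_def apply_c0_of)
qed

lemma evolution_semigroup_tendsto:
  "((\<lambda>t. evolution_semigroup V t v) \<longlongrightarrow> v) (at_right 0)"
proof (rule tendstoI)
  fix e :: real assume e: "0 < e"
  \<comment> \<open>The uniform bound for elapsed times up to 1, that is, with
    \<open>c = 1\<close>.\<close>
  define M where "M = K * exp \<bar>\<alpha>\<bar>"
  define g where "g = (\<lambda>(t, s). V s (s - t) (apply_c0 v (s - t)))"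
  have M: "0 \<le> M" by (simp add: M_def K_nonneg)
  \<comment> \<open>In the tail the transported value costs at most \<open>\<delta> * M\<close> and
    \<open>v\<close> itself at most \<open>\<delta>\<close>; together this is
    \<open>e / 2\<close>.\<close>
  define \<delta> where "\<delta> = e / 2 / (M + 1)"
  have \<delta>: "0 < \<delta>" "\<delta> * (M + 1) = e / 2"
    using M e by (simp_all add: \<delta>_def nonzero_divide_eq_eq[symmetric] del: divide_divide_eq_left)
  have "\<forall>\<^sub>F s in at_infinity. norm (apply_c0 v s) < \<delta>"
    using tendstoD[OF tendsto_apply_c0[of v], of \<delta>] \<delta> by simp
  then obtain b where b: "\<And>s. b \<le> \<bar>s\<bar> \<Longrightarrow> norm (apply_c0 v s) < \<delta>"
    unfolding eventually_at_infinity by auto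
  \<comment> \<open>The margin 1 ensures that for \<open>s\<close> outside the interval and
    \<open>t < 1\<close> the shifted point \<open>s - t\<close> still lies in the region where
    \<open>v\<close> is small.\<close>
  have "uniformly_continuous_on ({0..1} \<times> {- (b + 1)..b + 1}) g"
    unfolding g_def
    by (intro compact_uniformly_continuous compact_Times compact_Icc
        continuous_on_subset[OF continuous_on_evolution[of 1 v]]) auto
  then obtain d where d: "d > 0"
    and g: "\<And>p q. p \<in> {0..1} \<times> {- (b + 1)..b + 1} \<Longrightarrow> q \<in> {0..1} \<times> {- (b + 1)..b + 1} \<Longrightarrow>
      dist q p < d \<Longrightarrow> dist (g q) (g p) < e / 2"
    using e unfolding uniformly_continuous_on_def by (metis half_gt_zero)
  have "dist (evolution_semigroup V t v) v < e" if t: "0 < t" "t < min 1 d" for t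
  proof -
    \<comment> \<open>Passing to the supremum over \<open>s\<close> keeps only a weak inequality, so
      the target is \<open>e / 2\<close> rather than \<open>e\<close>.\<close>
    have "norm (V s (s - t) (apply_c0 v (s - t)) - apply_c0 v s) \<le> e / 2" for s
    proof (cases "\<bar>s\<bar> \<le> b + 1")
      case True
      \<comment> \<open>The two points are at distance \<open>t\<close>, and \<open>g (0, s)\<close>
        is the value of \<open>v\<close> at \<open>s\<close> because \<open>V s s\<close> is the
        identity.\<close>
      then have "dist (g (t, s)) (g (0, s)) < e / 2"
        using t by (intro g) (auto simp: dist_Pair_Pair)
      then show ?thesis by (simp add: g_def evol(2) dist_norm)
    next
      case False
      then have "b \<le> \<bar>s - t\<bar>" "b \<le> \<bar>s\<bar>" using t by auto
      then have "norm (apply_c0 v (s - t)) * M \<le> \<delta> * M"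
        "norm (apply_c0 v s) \<le> \<delta>"
        using b M by (blast intro: mult_right_mono less_imp_le)+
      moreover have "norm (V s (s - t) (apply_c0 v (s - t))) \<le> norm (apply_c0 v (s - t)) * M"
        using norm_apply_le_uniform[of t 1] t by (simp add: M_def)
      moreover have "\<delta> * M + \<delta> = e / 2"
        using \<delta>(2) by (simp add: distrib_left)
      ultimately show ?thesis
        using norm_triangle_ineq4[of "V s (s - t) (apply_c0 v (s - t))" "apply_c0 v s"] by linarith
    qed
    then have "norm (evolution_semigroup V t v - v) \<le> e / 2"
      using t by (intro norm_c0_leI) (simp add: apply_evolution_semigroup)
    then show ?thesis using e by (simp add: dist_norm)
  qed
  then show "\<forall>\<^sub>F t in at_right 0. dist (evolution_semigroup V t v) v < e"
    using d by (auto simp: eventually_at_right_field intro!: exI[of _ "min 1 d"])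
qed

lemma C0_semigroup_evolution_semigroup: "C0_semigroup (c0_scale smul) (evolution_semigroup V)"
  unfolding C0_semigroup_def
proof (intro conjI allI impI)
  fix t :: real assume t: "0 \<le> t"
  show "bounded_operator (c0_scale smul) (evolution_semigroup V t)"
  proof (rule bounded_operator_intro[OF normed_scaling_c0])
    fix u v :: "'a c0" and c
    show "evolution_semigroup V t (u + v) = evolution_semigroup V t u + evolution_semigroup V t v"
      by (rule c0_eqI) (simp add: apply_evolution_semigroup t blinfun.add_right)
    show "evolution_semigroup V t (c0_scale smul c u) = c0_scale smul c (evolution_semigroup V t u)"
      by (rule c0_eqI) (simp add: apply_evolution_semigroup apply_c0_scale t evol(1))
    show "norm (evolution_semigroup V t u) \<le> norm u * (K * exp (\<bar>\<alpha>\<bar> * t))"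
    proof (rule norm_c0_leI)
      fix s
      have "norm (V s (s - t) (apply_c0 u (s - t))) \<le>
          norm (apply_c0 u (s - t)) * (K * exp (\<bar>\<alpha>\<bar> * t))"
        by (rule norm_apply_le_uniform) (use t in auto)
      also have "\<dots> \<le> norm u * (K * exp (\<bar>\<alpha>\<bar> * t))"
        by (intro mult_right_mono norm_apply_c0_le) (simp add: K_nonneg)
      finally show "norm (apply_c0 (evolution_semigroup V t u) s) \<le> norm u * (K * exp (\<bar>\<alpha>\<bar> * t))"
        by (simp add: apply_evolution_semigroup t)
    qed
  qed
next
  show "evolution_semigroup V 0 = id"
    by (rule ext, rule c0_eqI) (simp add: apply_evolution_semigroup evol(2))
next
  fix t s :: real assume "0 \<le> t" "0 \<le> s"
  \<comment> \<open>At a point \<open>r\<close>, the composition law of \<open>V\<close> is used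
    with the intermediate time \<open>r - t\<close>.\<close>
  then show "evolution_semigroup V (t + s) = evolution_semigroup V t \<circ> evolution_semigroup V s"
    by (intro ext c0_eqI) (simp add: apply_evolution_semigroup evol(3) diff_diff_eq)
next
  fix v :: "'a c0"
  show "((\<lambda>t. evolution_semigroup V t v) \<longlongrightarrow> v) (at_right 0)"
    by (rule evolution_semigroup_tendsto)
qed

end

theorem mainTheorem4:
  fixes smul :: "'k::real_normed_field \<Rightarrow> 'a::banach \<Rightarrow> 'a"
    and \<mu> :: "real \<Rightarrow> real"
    and U V :: "real \<Rightarrow> real \<Rightarrow> 'a \<Rightarrow>\<^sub>L 'a"
    and \<alpha> K :: real
    and T S :: "real \<Rightarrow> 'a c0 \<Rightarrow> 'a c0"
    and F Finv :: "'a c0 \<Rightarrow> 'a c0"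
  assumes "normed_scaling smul"
    and "\<mu> \<in> A_infinity"
    and "evolution_family smul U"
    and "\<alpha> > 0" and "K \<ge> 1"
    and "\<And>s \<tau>. s \<ge> \<tau> \<Longrightarrow> norm (U s \<tau>) \<le> K * exp (\<alpha> * (\<mu> s - \<mu> \<tau>))"
    and T_def: "T = gen_evolution_semigroup \<mu> U"
    and V_def: "V = (\<lambda>t s. U (inv \<mu> t) (inv \<mu> s))"
    and S_def: "S = evolution_semigroup V"
    and F_def: "F = c0_compose (inv \<mu>)"
    and Finv_def: "Finv = c0_compose \<mu>"
  shows
    \<comment> \<open>all operators are well defined, i.e. given pointwise by their defining formulas\<close>
    "(\<forall>t\<ge>0. \<forall>u s. apply_c0 (T t u) s =
        blinfun_apply (U s (inv \<mu> (\<mu> s - t))) (apply_c0 u (inv \<mu> (\<mu> s - t)))) \<and>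
     (\<forall>t\<ge>0. \<forall>v s. apply_c0 (S t v) s = blinfun_apply (V s (s - t)) (apply_c0 v (s - t))) \<and>
     (\<forall>u. apply_c0 (F u) = apply_c0 u \<circ> inv \<mu>) \<and>
     (\<forall>v. apply_c0 (Finv v) = apply_c0 v \<circ> \<mu>) \<and>
     C0_semigroup (c0_scale smul) T \<and>
     C0_semigroup (c0_scale smul) S \<and>
     evolution_family smul V \<and>
     (\<forall>t s. t \<ge> s \<longrightarrow> norm (V t s) \<le> K * exp (\<alpha> * (t - s))) \<and>
     bounded_operator (c0_scale smul) F \<and>
     bounded_operator (c0_scale smul) Finv \<and>
     Finv \<circ> F = id \<and> F \<circ> Finv = id \<and>
     (\<forall>t\<ge>0. T t = Finv \<circ> S t \<circ> F) \<and>
     generator_domain T = {u. F u \<in> generator_domain S} \<and>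
     (\<forall>u\<in>generator_domain T. generator T u = Finv (generator S (F u))) \<and>
     spectrum (c0_scale smul) (generator_domain T) (generator T) =
       spectrum (c0_scale smul) (generator_domain S) (generator S)"
proof -
  interpret normed_scaling smul by fact
  have inv_\<mu>: "inv \<mu> \<in> A_infinity" by (rule A_infinity_inv) fact
  have bij: "bij \<mu>"
    using \<open>\<mu> \<in> A_infinity\<close> by (auto simp: A_infinity_iff bij_def strict_mono_imp_inj_on)
  have \<mu>_inv: "\<mu> (inv \<mu> x) = x" and inv_\<mu>_\<mu>: "inv \<mu> (\<mu> x) = x" for x
    using bij by (simp_all add: bij_is_surj surj_f_inv_f bij_is_inj)
  have inv_mono: "mono (inv \<mu>)" "continuous_on UNIV (inv \<mu>)"
    using inv_\<mu> by (auto simp: A_infinity_def strict_mono_mono)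
  have V: "evolution_family smul V"
    unfolding V_def by (rule evolution_family_reparametrize) fact+
  have V_le: "norm (V t s) \<le> K * exp (\<alpha> * (t - s))" if "s \<le> t" for t s
    \<comment> \<open>At the times \<open>inv \<mu> t\<close> and \<open>inv \<mu> s\<close> the
      increment of \<open>\<mu>\<close> in the exponent becomes \<open>t - s\<close>.\<close>
    using assms(6)[OF monoD[OF inv_mono(1) that]] by (simp add: V_def \<mu>_inv)
  interpret V: exp_bounded_evolution_family smul V K \<alpha>
    by unfold_locales (fact V V_le)+
  note S_apply = V.apply_evolution_semigroup[folded S_def]
  have S: "C0_semigroup (c0_scale smul) S"
    unfolding S_def by (rule V.C0_semigroup_evolution_semigroup)
  have F_apply: "apply_c0 (F u) = apply_c0 u \<circ> inv \<mu>" for u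
    unfolding F_def by (rule apply_c0_compose) fact
  have Finv_apply: "apply_c0 (Finv u) = apply_c0 u \<circ> \<mu>" for u
    unfolding Finv_def by (rule apply_c0_compose) fact
  have F: "bounded_operator (c0_scale smul) F"
    unfolding F_def by (rule bounded_operator_c0_compose) fact+
  have Finv: "bounded_operator (c0_scale smul) Finv"
    unfolding Finv_def by (rule bounded_operator_c0_compose) fact+
  have FF: "F \<circ> Finv = id" "Finv \<circ> F = id"
    by (rule ext, rule c0_eqI, simp add: F_apply Finv_apply \<mu>_inv inv_\<mu>_\<mu>)+
  have T_eq: "T t = Finv \<circ> S t \<circ> F" if t: "0 \<le> t" for t
  proof
    fix u
    \<comment> \<open>The conjugate is already an element of \<open>c0\<close>, so its pointwise
      formula is continuous and vanishes at infinity. Hence \<open>c0_of\<close> in the definition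
      of \<open>T\<close> returns exactly this function, and \<open>T\<close> needs no estimate of
      its own.\<close>
    have "apply_c0 ((Finv \<circ> S t \<circ> F) u) =
        (\<lambda>s. U s (inv \<mu> (\<mu> s - t)) (apply_c0 u (inv \<mu> (\<mu> s - t))))"
      using t by (auto simp: Finv_apply F_apply S_apply V_def inv_\<mu>_\<mu>)
    then show "T t u = (Finv \<circ> S t \<circ> F) u"
      unfolding T_def gen_evolution_semigroup_def
      by (metis apply_c0_of c0_eqI continuous_apply_c0 tendsto_apply_c0)
  qed
  then have T_apply: "apply_c0 (T t u) s =
      U s (inv \<mu> (\<mu> s - t)) (apply_c0 u (inv \<mu> (\<mu> s - t)))" if "0 \<le> t" for t u s
    using that by (simp add: Finv_apply F_apply S_apply V_def inv_\<mu>_\<mu>)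
  \<comment> \<open>The premises of the similarity lemmas in their order, with \<open>F\<close> as
    \<open>P\<close> and \<open>Finv\<close> as \<open>Q\<close>.\<close>
  note similar = F Finv FF T_eq
  show ?thesis
  proof (intro conjI)
    show "C0_semigroup (c0_scale smul) T" by (rule C0_semigroup_similar[OF S similar])
    show "generator_domain T = {u. F u \<in> generator_domain S}"
      by (rule generator_domain_similar[OF similar])
    show "\<forall>u\<in>generator_domain T. generator T u = Finv (generator S (F u))"
      by (intro ballI generator_eq_similar[OF similar])
    show "spectrum (c0_scale smul) (generator_domain T) (generator T) =
        spectrum (c0_scale smul) (generator_domain S) (generator S)"
      by (rule spectrum_similar[OF similar])
  qed (use S V V_le F Finv FF T_eq T_apply S_apply F_apply Finv_apply in blast)+
qed

end
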